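(* Let $X$ be a (real) Banach space with norm $|\cdot|$, ordered by a cone $K$, such that the norm is semi-monotone with respect to $K$. Let $L\colon X\to X$ be a linear operator, $F\colon K\to K$ a continuous (nonlinear) mapping, and $N:=LF$. Let $\Phi\colon K\to\mathbb{R}_+$ satisfy $\Phi(\alpha u)=\alpha\Phi(u)$ for all $\alpha>0$, $u\in K$, and $\Phi(u)=0$ if and only if $u=0$. Assume: (i) $L(K)\subset K$, and $L$ admits an eigenvalue $\lambda_1>0$ with a corresponding eigenvector $\varphi_1\in K\setminus\{0\}$, i.e. $L\varphi_1=\lambda_1\varphi_1$; (ii) for $u,v\in K$, $0\le u\le v$ implies $F(u)\le F(v)$; (iii) there exists a constant $r>0$ such that $F(\lambda_1u)\ge u$ for all $u\in K$ with $\Phi(u)=r$; (iv) there exist $\alpha>0$ and $\mu\in K\setminus\{0\}$ such that $L\mu\le\alpha\mu$ and $F(\alpha\mu)\le\mu$. Set $$\underline{u}=\frac{r}{\Phi(\varphi_1)}L(\varphi_1),\qquad \overline{u}=L\mu .$$ Then $\underline{u}$ is a lower solution and $\overline{u}$ is an upper solution of the equation $u=LF(u)$, that is, $\underline{u}\le N(\underline{u})$ and $\overline{u}\ge N(\overline{u})$.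
   Context: A cone $K\subset X$ is a closed convex set with $tK\subset K$ for all $t\ge0$, $K\cap(-K)=\{0\}$ and $K\ne\{0\}$. The order is $u\le v$ iff $v-u\in K$. The norm is semi-monotone if there is $\gamma>0$ such that $0\le u\le v$ implies $|u|\le\gamma|v|$. $N=LF$ denotes the composition $N(u)=L(F(u))$, $u\in K$. *)

theory Defs
  imports "HOL-Analysis.Analysis"
begin

text \<open>The library predicate \<^const>\<open>cone\<close> only states closure under scaling by nonnegative reals.\<close>

definition order_cone :: "'a::real_normed_vector set \<Rightarrow> bool" where
  "order_cone K \<longleftrightarrow> closed K \<and> convex K \<and> cone K \<and> K \<inter> uminus ` K = {0} \<and> K \<noteq> {0}"

definition cone_le :: "'a::real_normed_vector set \<Rightarrow> 'a \<Rightarrow> 'a \<Rightarrow> bool" where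
  "cone_le K u v \<longleftrightarrow> v - u \<in> K"

definition semi_monotone_norm :: "'a::real_normed_vector set \<Rightarrow> bool" where
  "semi_monotone_norm K \<longleftrightarrow>
     (\<exists>\<gamma>>0. \<forall>u v. cone_le K 0 u \<and> cone_le K u v \<longrightarrow> norm u \<le> \<gamma> * norm v)"

text \<open>Lower and upper solutions of \<open>u = N u\<close>. Membership in \<open>K\<close> is required because
  \<open>N\<close> is an operator on \<open>K\<close>; its values outside \<open>K\<close> are irrelevant.\<close>

definition lower_solution :: "'a::real_normed_vector set \<Rightarrow> ('a \<Rightarrow> 'a) \<Rightarrow> 'a \<Rightarrow> bool" where
  "lower_solution K N u \<longleftrightarrow> u \<in> K \<and> cone_le K u (N u)"

definition upper_solution :: "'a::real_normed_vector set \<Rightarrow> ('a \<Rightarrow> 'a) \<Rightarrow> 'a \<Rightarrow> bool" where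
  "upper_solution K N u \<longleftrightarrow> u \<in> K \<and> cone_le K (N u) u"

end

theory Submission
  imports Defs
begin

text \<open>
  Both inequalities come from applying the positive linear operator \<open>L\<close>, which preserves the order, to
  a comparison between values of \<open>F\<close>.

  For the lower solution, rescale the eigenvector to \<open>v = (r / \<Phi> \<phi>\<^sub>1) \<phi>\<^sub>1\<close>, so that \<open>\<Phi> v = r\<close>. The
  candidate is then at the same time \<open>L v\<close> and \<open>\<lambda>\<^sub>1 v\<close>: the second form makes the expansion condition
  \<open>v \<le> F (\<lambda>\<^sub>1 v)\<close> a bound on \<open>F\<close> at the candidate, and applying \<open>L\<close> turns its left-hand side into the
  first form.

  For the upper solution, monotonicity of \<open>F\<close> carries \<open>L \<mu> \<le> \<alpha> \<mu>\<close> to \<open>F (L \<mu>) \<le> F (\<alpha> \<mu>) \<le> \<mu>\<close>, and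
  applying \<open>L\<close> gives the claim.
\<close>

lemma cone_le_trans:
  assumes "convex K" "cone K" "cone_le K u v" "cone_le K v w"
  shows "cone_le K u w"
proof -
  have "(v - u) + (w - v) \<in> K"
    using assms convex_cone[of K] unfolding cone_le_def by blast
  then show ?thesis by (simp add: cone_le_def)
qed

lemma linear_positive_mono:
  assumes "linear L" "L ` K \<subseteq> K" "cone_le K u v"
  shows "cone_le K (L u) (L v)"
proof -
  have "L (v - u) \<in> K"
    using assms(2,3) unfolding cone_le_def by blast
  then show ?thesis
    by (simp add: cone_le_def linear_diff[OF assms(1)])
qed

theorem theorem3:
  fixes K :: "'a::banach set"
    and L F :: "'a \<Rightarrow> 'a"
    and \<Phi> :: "'a \<Rightarrow> real"
    and lam\<^sub>1 r \<alpha> :: real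
    and \<phi>\<^sub>1 \<mu> :: 'a
  assumes "order_cone K"
    and "semi_monotone_norm K"
    and "linear L"
    and "F \<in> K \<rightarrow> K" and "continuous_on K F"
    and "\<And>u. u \<in> K \<Longrightarrow> \<Phi> u \<ge> 0"
    and "\<And>c u. c > 0 \<Longrightarrow> u \<in> K \<Longrightarrow> \<Phi> (c *\<^sub>R u) = c * \<Phi> u"
    and "\<And>u. u \<in> K \<Longrightarrow> \<Phi> u = 0 \<longleftrightarrow> u = 0"
    and "L ` K \<subseteq> K"
    and "lam\<^sub>1 > 0" and "\<phi>\<^sub>1 \<in> K - {0}" and "L \<phi>\<^sub>1 = lam\<^sub>1 *\<^sub>R \<phi>\<^sub>1"
    and "\<And>u v. u \<in> K \<Longrightarrow> v \<in> K \<Longrightarrow> cone_le K 0 u \<Longrightarrow> cone_le K u v \<Longrightarrow> cone_le K (F u) (F v)"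
    and "r > 0" and "\<And>u. u \<in> K \<Longrightarrow> \<Phi> u = r \<Longrightarrow> cone_le K u (F (lam\<^sub>1 *\<^sub>R u))"
    and "\<alpha> > 0" and "\<mu> \<in> K - {0}"
    and "cone_le K (L \<mu>) (\<alpha> *\<^sub>R \<mu>)" and "cone_le K (F (\<alpha> *\<^sub>R \<mu>)) \<mu>"
  shows "lower_solution K (L \<circ> F) ((r / \<Phi> \<phi>\<^sub>1) *\<^sub>R L \<phi>\<^sub>1) \<and> upper_solution K (L \<circ> F) (L \<mu>)"
proof
  have conv: "convex K" and cone: "cone K"
    using assms(1) unfolding order_cone_def by auto
  have LK: "L x \<in> K" if "x \<in> K" for x
    using that assms(9) by blast
  note L_mono = linear_positive_mono[OF \<open>linear L\<close> \<open>L ` K \<subseteq> K\<close>]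
  show "lower_solution K (L \<circ> F) ((r / \<Phi> \<phi>\<^sub>1) *\<^sub>R L \<phi>\<^sub>1)"
  proof -
    have phi: "\<phi>\<^sub>1 \<in> K" and "\<phi>\<^sub>1 \<noteq> 0"
      using assms(11) by auto
    then have Phi_pos: "\<Phi> \<phi>\<^sub>1 > 0"
      using assms(6,8)[OF phi] by linarith
    define v where "v = (r / \<Phi> \<phi>\<^sub>1) *\<^sub>R \<phi>\<^sub>1"
    have v: "v \<in> K"
      unfolding v_def using cone phi \<open>r > 0\<close> Phi_pos by (auto intro: mem_cone)
    have Phi_v: "\<Phi> v = r"
      unfolding v_def using assms(7)[OF _ phi, of "r / \<Phi> \<phi>\<^sub>1"] \<open>r > 0\<close> Phi_pos by simp
    have candidate: "(r / \<Phi> \<phi>\<^sub>1) *\<^sub>R L \<phi>\<^sub>1 = L v"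
      by (simp add: v_def linear_scale[OF \<open>linear L\<close>])
    have eigen: "L v = lam\<^sub>1 *\<^sub>R v"
      unfolding candidate[symmetric] by (simp add: v_def assms(12) mult.commute)
    have "cone_le K v (F (L v))"
      using assms(15)[OF v Phi_v] by (simp add: eigen)
    then have "cone_le K (L v) (L (F (L v)))"
      by (rule L_mono)
    then show ?thesis
      unfolding lower_solution_def candidate using LK[OF v] by simp
  qed
  show "upper_solution K (L \<circ> F) (L \<mu>)"
  proof -
    have mu: "\<mu> \<in> K"
      using assms(17) by blast
    have scaled: "\<alpha> *\<^sub>R \<mu> \<in> K"
      using cone mu \<open>\<alpha> > 0\<close> by (auto intro: mem_cone)
    have "cone_le K 0 (L \<mu>)"
      using LK[OF mu] by (simp add: cone_le_def)
    then have "cone_le K (F (L \<mu>)) (F (\<alpha> *\<^sub>R \<mu>))"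
      using assms(13)[OF LK[OF mu] scaled] assms(18) by blast
    then have "cone_le K (F (L \<mu>)) \<mu>"
      using cone_le_trans[OF conv cone] assms(19) by blast
    then have "cone_le K (L (F (L \<mu>))) (L \<mu>)"
      by (rule L_mono)
    then show ?thesis
      unfolding upper_solution_def using LK[OF mu] by simp
  qed
qed

end
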